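(* Let $\mathbf{l}\in\mathbb{R}^3$ be nonzero with $l=|\mathbf{l}|$, let $\mathbf{n}$ be a unit vector with $\mathbf{n}\cdot\mathbf{l}=0$, and for $\epsilon>0$ let $$H(\epsilon)=l^2\int_0^1\int_0^1\frac{ds_2\,ds_1}{|\mathbf{l}s_1-\mathbf{l}s_2+\epsilon\mathbf{n}|}.$$ Then $$H(\epsilon)=2l^2\left(\frac1l\ln\frac{l+(l^2+\epsilon^2)^{1/2}}{\epsilon}-\frac{1}{(l^2+\epsilon^2)^{1/2}+\epsilon}\right),$$ and $H(\epsilon)\sim 2l\left(\ln\frac{2l}{\epsilon}-1\right)$ as $\epsilon\to0$.
   Context: $H(\epsilon)$ is the double edge integral of $1/|\mathbf{x}-\mathbf{y}|$ over an edge of a source triangle and the same edge (same orientation) of a receiver triangle, displaced by $\epsilon$ in a direction normal to the edge ("two-touch" case). $f\sim g$ means $f/g\to1$. *)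

theory Defs
  imports "HOL-Analysis.Analysis" "HOL-Library.Landau_Symbols"
begin

definition two_touch_H :: "real ^ 3 \<Rightarrow> real ^ 3 \<Rightarrow> real \<Rightarrow> real" where
  "two_touch_H L n \<epsilon> =
     (norm L)\<^sup>2 * integral {0..1} (\<lambda>s1. integral {0..1} (\<lambda>s2.
        1 / norm (s1 *\<^sub>R L - s2 *\<^sub>R L + \<epsilon> *\<^sub>R n)))"

end

theory Submission
  imports Defs "HOL-Real_Asymp.Real_Asymp"
begin

text \<open>
  By orthogonality the integrand is \<open>1 / sqrt (l\<^sup>2 (s1 - s2)\<^sup>2 + \<epsilon>\<^sup>2)\<close>, a function \<open>k (s1 - s2)\<close> with
  \<open>k\<close> even. If \<open>G'' = k\<close> with \<open>G\<close> even, the double integral over the unit square is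
  \<open>G 1 - 2 G 0 + G (-1) = 2 (G 1 - G 0)\<close>; here \<open>G\<close> is explicit in terms of \<open>arsinh\<close>.
\<close>

lemma norm_parallel_edge_difference:
  fixes L n :: "'a::real_inner"
  assumes "norm n = 1" and "n \<bullet> L = 0"
  shows "norm (s *\<^sub>R L - t *\<^sub>R L + \<epsilon> *\<^sub>R n) = sqrt ((norm L)\<^sup>2 * (s - t)\<^sup>2 + \<epsilon>\<^sup>2)"
proof -
  have "(norm ((s - t) *\<^sub>R L + \<epsilon> *\<^sub>R n))\<^sup>2 = (norm ((s - t) *\<^sub>R L))\<^sup>2 + (norm (\<epsilon> *\<^sub>R n))\<^sup>2"
    using assms(2) by (intro norm_add_Pythagorean) (simp add: orthogonal_def inner_commute)
  also have "\<dots> = (norm L)\<^sup>2 * (s - t)\<^sup>2 + \<epsilon>\<^sup>2"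
    using assms(1) by (simp add: power_mult_distrib)
  finally show ?thesis
    by (metis norm_ge_zero real_sqrt_unique scaleR_left_diff_distrib)
qed

context
  fixes l \<epsilon> :: real
  assumes l: "l > 0" and \<epsilon>: "\<epsilon> > 0"
begin

text \<open>Pulling \<open>\<epsilon>\<close> out of the root leaves the derivative of
  \<open>arsinh\<close> at \<open>l * u / \<epsilon>\<close>; the chain-rule factor
  \<open>l / \<epsilon>\<close> is absorbed by that \<open>\<epsilon>\<close> and the division by
  \<open>l\<close>.\<close>

lemma arsinh_scaled_has_derivative:
  "((\<lambda>u. arsinh (l * u / \<epsilon>) / l) has_real_derivative 1 / sqrt (l\<^sup>2 * u\<^sup>2 + \<epsilon>\<^sup>2)) (at u within A)"
proof -
  have "l\<^sup>2 * u\<^sup>2 + \<epsilon>\<^sup>2 = \<epsilon>\<^sup>2 * ((l * u / \<epsilon>)\<^sup>2 + 1)"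
    using \<epsilon> by (simp add: field_simps)
  then have "sqrt (l\<^sup>2 * u\<^sup>2 + \<epsilon>\<^sup>2) = \<epsilon> * sqrt ((l * u / \<epsilon>)\<^sup>2 + 1)"
    using \<epsilon> by (simp add: real_sqrt_mult)
  then show ?thesis
    using l \<epsilon>
    by (auto intro!: derivative_eq_intros DERIV_chain2[OF arsinh_real_has_field_derivative])
qed

text \<open>Integration by parts: differentiating the product leaves, besides
  \<open>arsinh (l * u / \<epsilon>) / l\<close>, the term \<open>u\<close> times the kernel, which
  is exactly the derivative of the subtracted root.\<close>

lemma kernel_second_antiderivative:
  "((\<lambda>u. u * (arsinh (l * u / \<epsilon>) / l) - sqrt (l\<^sup>2 * u\<^sup>2 + \<epsilon>\<^sup>2) / l\<^sup>2)
     has_real_derivative arsinh (l * u / \<epsilon>) / l) (at u within A)"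
proof -
  \<comment> \<open>Strict positivity keeps the root differentiable even at
    \<open>u = 0\<close>.\<close>
  have "0 < l\<^sup>2 * u\<^sup>2 + \<epsilon>\<^sup>2"
    using \<epsilon> by (simp add: add_nonneg_pos)
  then have "((\<lambda>u. sqrt (l\<^sup>2 * u\<^sup>2 + \<epsilon>\<^sup>2) / l\<^sup>2) has_real_derivative
               u / sqrt (l\<^sup>2 * u\<^sup>2 + \<epsilon>\<^sup>2)) (at u within A)"
    using l by (auto intro!: derivative_eq_intros simp: divide_simps)
  from DERIV_diff[OF DERIV_mult[OF DERIV_ident arsinh_scaled_has_derivative] this]
  show ?thesis
    by simp
qed

lemma kernel_inner_integral:
  "((\<lambda>t. 1 / sqrt (l\<^sup>2 * (s - t)\<^sup>2 + \<epsilon>\<^sup>2)) has_integral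
     arsinh (l * s / \<epsilon>) / l - arsinh (l * (s - 1) / \<epsilon>) / l) {0..1}"
proof -
  \<comment> \<open>The outer minus sign compensates the inner derivative -1 of
    \<open>s - t\<close>.\<close>
  have "((\<lambda>t. - (arsinh (l * (s - t) / \<epsilon>) / l)) has_vector_derivative
          1 / sqrt (l\<^sup>2 * (s - t)\<^sup>2 + \<epsilon>\<^sup>2)) (at t within {0..1})" for t
    unfolding has_real_derivative_iff_has_vector_derivative[symmetric]
    by (rule derivative_eq_intros DERIV_chain2[OF arsinh_scaled_has_derivative] refl | simp)+
  from fundamental_theorem_of_calculus[of 0 1, OF _ this] show ?thesis
    by simp
qed

lemma kernel_double_integral:
  "integral {0..1} (\<lambda>s. integral {0..1} (\<lambda>t. 1 / sqrt (l\<^sup>2 * (s - t)\<^sup>2 + \<epsilon>\<^sup>2))) =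
     2 * (arsinh (l / \<epsilon>) / l - (sqrt (l\<^sup>2 + \<epsilon>\<^sup>2) - \<epsilon>) / l\<^sup>2)"
proof -
  define F where "F = (\<lambda>u. arsinh (l * u / \<epsilon>) / l)"
  define G where "G = (\<lambda>u. u * F u - sqrt (l\<^sup>2 * u\<^sup>2 + \<epsilon>\<^sup>2) / l\<^sup>2)"
  have G': "(G has_real_derivative F u) (at u within A)" for u A
    unfolding F_def G_def by (rule kernel_second_antiderivative)
  \<comment> \<open>The inner integral is a unit difference of \<open>F\<close>, so the same
    difference of \<open>G\<close> integrates it, and the outer integral becomes a second difference
    of \<open>G\<close> at 0.\<close>
  have "((\<lambda>s. G s - G (s - 1)) has_vector_derivative F s - F (s - 1)) (at s within {0..1})" for s
    unfolding has_real_derivative_iff_has_vector_derivative[symmetric]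
    by (rule derivative_eq_intros G' DERIV_chain2[OF G'] refl | simp)+
  from fundamental_theorem_of_calculus[of 0 1, OF _ this]
  have "((\<lambda>s. F s - F (s - 1)) has_integral (G 1 - G 0) - (G 0 - G (- 1))) {0..1}"
    by simp
  moreover have "integral {0..1} (\<lambda>t. 1 / sqrt (l\<^sup>2 * (s - t)\<^sup>2 + \<epsilon>\<^sup>2)) = F s - F (s - 1)" for s
    unfolding F_def by (rule integral_unique[OF kernel_inner_integral])
  \<comment> \<open>\<open>F\<close> is odd, so \<open>G (- 1) = G 1\<close>; the lone
    \<open>\<epsilon>\<close> comes from \<open>G 0\<close>, where the root of
    \<open>\<epsilon>\<^sup>2\<close> is \<open>\<epsilon>\<close> by positivity.\<close>
  moreover have "(G 1 - G 0) - (G 0 - G (- 1)) = 2 * (F 1 - (sqrt (l\<^sup>2 + \<epsilon>\<^sup>2) - \<epsilon>) / l\<^sup>2)"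
    using \<epsilon> by (simp add: G_def F_def arsinh_minus_real diff_divide_distrib)
  ultimately show ?thesis
    by (simp add: integral_unique F_def)
qed

text \<open>Two rewritings: the logarithmic form of \<open>arsinh\<close>, and rationalisation by
  \<open>(S - \<epsilon>) * (S + \<epsilon>) = l\<^sup>2\<close>, where \<open>S\<close> is the
  root.\<close>

lemma kernel_double_integral_closed_form:
  "integral {0..1} (\<lambda>s. integral {0..1} (\<lambda>t. 1 / sqrt (l\<^sup>2 * (s - t)\<^sup>2 + \<epsilon>\<^sup>2))) =
     2 * (1 / l * ln ((l + sqrt (l\<^sup>2 + \<epsilon>\<^sup>2)) / \<epsilon>) - 1 / (sqrt (l\<^sup>2 + \<epsilon>\<^sup>2) + \<epsilon>))"
proof -
  define S where "S = sqrt (l\<^sup>2 + \<epsilon>\<^sup>2)"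
  have "S\<^sup>2 = l\<^sup>2 + \<epsilon>\<^sup>2" and "S \<ge> 0"
    by (simp_all add: S_def)
  then have "(S - \<epsilon>) / l\<^sup>2 = 1 / (S + \<epsilon>)"
    using l \<epsilon> by (simp add: field_simps power2_eq_square add_nonneg_pos)
  moreover have "arsinh (l / \<epsilon>) = ln ((l + S) / \<epsilon>)"
  proof -
    have "(l / \<epsilon>)\<^sup>2 + 1 = (l\<^sup>2 + \<epsilon>\<^sup>2) / \<epsilon>\<^sup>2"
      using \<epsilon> by (simp add: field_simps)
    then have "sqrt ((l / \<epsilon>)\<^sup>2 + 1) = S / \<epsilon>"
      using \<epsilon> by (simp add: S_def real_sqrt_divide)
    then show ?thesis
      by (simp add: arsinh_real_def add_divide_distrib)
  qed
  ultimately show ?thesis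
    by (simp add: kernel_double_integral flip: S_def)
qed

end

lemma two_touch_H_closed_form:
  fixes L n :: "real ^ 3"
  assumes "L \<noteq> 0" and "norm n = 1" and "n \<bullet> L = 0" and "\<epsilon> > 0"
  defines "l \<equiv> norm L"
  shows "two_touch_H L n \<epsilon> =
    2 * l\<^sup>2 * (1 / l * ln ((l + sqrt (l\<^sup>2 + \<epsilon>\<^sup>2)) / \<epsilon>) - 1 / (sqrt (l\<^sup>2 + \<epsilon>\<^sup>2) + \<epsilon>))"
  using kernel_double_integral_closed_form[of l \<epsilon>] assms(1,4)
  by (simp add: two_touch_H_def norm_parallel_edge_difference[OF assms(2,3)] l_def)

text \<open>As \<open>\<epsilon>\<close> tends to 0 from the right, the root tends to
  \<open>l\<close>. Inside the bracket, after extracting \<open>2 * l\<close>, both the change in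
  the logarithm and the change of the last term to 1 are o(1), negligible against the divergent
  \<open>ln (2 * l / \<epsilon>)\<close>.\<close>

lemma two_touch_closed_form_asymp:
  fixes l :: real
  assumes "l > 0"
  shows "(\<lambda>\<epsilon>. 2 * l\<^sup>2 * (1 / l * ln ((l + sqrt (l\<^sup>2 + \<epsilon>\<^sup>2)) / \<epsilon>) - 1 / (sqrt (l\<^sup>2 + \<epsilon>\<^sup>2) + \<epsilon>)))
           \<sim>[at_right 0] (\<lambda>\<epsilon>. 2 * l * (ln (2 * l / \<epsilon>) - 1))"
proof -
  have "2 * l\<^sup>2 * (1 / l * a - 1 / b) = 2 * l * (a - l / b)" for a b
    using assms by (simp add: right_diff_distrib power2_eq_square)
  moreover have "(\<lambda>\<epsilon>. 2 * l * (ln ((l + sqrt (l\<^sup>2 + \<epsilon>\<^sup>2)) / \<epsilon>) - l / (sqrt (l\<^sup>2 + \<epsilon>\<^sup>2) + \<epsilon>)))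
           \<sim>[at_right 0] (\<lambda>\<epsilon>. 2 * l * (ln (2 * l / \<epsilon>) - 1))"
    using assms by real_asymp
  ultimately show ?thesis
    by (simp only:)
qed

theorem mainTheorem6:
  fixes L n :: "real ^ 3" and l :: real
  assumes "L \<noteq> 0" and "l = norm L" and "norm n = 1" and "n \<bullet> L = 0"
  shows "(\<forall>\<epsilon>>0. two_touch_H L n \<epsilon> =
            2 * l\<^sup>2 * (1 / l * ln ((l + sqrt (l\<^sup>2 + \<epsilon>\<^sup>2)) / \<epsilon>)
                      - 1 / (sqrt (l\<^sup>2 + \<epsilon>\<^sup>2) + \<epsilon>)))
         \<and> (\<lambda>\<epsilon>. two_touch_H L n \<epsilon>) \<sim>[at_right 0] (\<lambda>\<epsilon>. 2 * l * (ln (2 * l / \<epsilon>) - 1))"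
proof
  show closed: "\<forall>\<epsilon>>0. two_touch_H L n \<epsilon> =
            2 * l\<^sup>2 * (1 / l * ln ((l + sqrt (l\<^sup>2 + \<epsilon>\<^sup>2)) / \<epsilon>)
                      - 1 / (sqrt (l\<^sup>2 + \<epsilon>\<^sup>2) + \<epsilon>))"
    using two_touch_H_closed_form assms by blast
  have "l > 0"
    using assms by simp
  then show "(\<lambda>\<epsilon>. two_touch_H L n \<epsilon>) \<sim>[at_right 0] (\<lambda>\<epsilon>. 2 * l * (ln (2 * l / \<epsilon>) - 1))"
    \<comment> \<open>The closed form is known only for positive \<open>\<epsilon>\<close>, which is
      all that the filter \<open>at_right 0\<close> sees.\<close>
    by (rule asymp_equiv_transfer[OF two_touch_closed_form_asymp])
       (use closed in \<open>auto simp: eventually_at_filter\<close>)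
qed

end
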